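(* Let $\mathbf{K}$ be an infinite field and let $V$ be a finite-dimensional $\mathbf{K}$-vector space of dimension at least $2$, equipped with the induced Zariski topology. Then $\sigma_{\tau}(V,\mathbf{K})=\sigma(V,\mathbf{K})=|\mathbf{K}|+1$.
   Context: Induced Zariski topology on a finite-dimensional $\mathbf{K}$-vector space $V$, $\dim V=n$: choose an ordered basis, giving a linear isomorphism $V\cong\mathbf{K}^n$; the closed sets of $V$ are the sets corresponding to common zero sets in $\mathbf{K}^n$ of families $\mathcal{F}\subseteq\mathbf{K}[X_1,\dots,X_n]$ of polynomials. (This does not depend on the basis.) $\sigma(V,\mathbf{K})$ denotes the minimum cardinal number of proper $\mathbf{K}$-subspaces of $V$ whose union is $V$. $\sigma_\tau(V,\mathbf{K})$ denotes the minimum cardinal number of proper closed subsets of $V$ (in the induced Zariski topology) whose union is $V$. Sums are cardinal arithmetic. *)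

theory Defs
  imports "HOL-Library.Poly_Mapping" "HOL-Analysis.Abstract_Topology"
begin

unbundle cardinal_syntax

section \<open>Multivariate polynomials\<close>

text \<open>A polynomial is a finitely supported map from monomials to coefficients, and a monomial is a
  finitely supported map from variable indices to exponents. The variables are numbered from 0, so
  that \<open>mpolys n\<close> is the polynomial ring in the variables \<open>X\<^sub>i\<close> with \<open>i < n\<close>.\<close>

type_synonym 'k mpoly = "(nat \<Rightarrow>\<^sub>0 nat) \<Rightarrow>\<^sub>0 'k"

definition mpolys :: "nat \<Rightarrow> 'k::zero mpoly set" where
  "mpolys n = {p. \<forall>m \<in> Poly_Mapping.keys p. Poly_Mapping.keys m \<subseteq> {..<n}}"

definition mono_eval :: "(nat \<Rightarrow>\<^sub>0 nat) \<Rightarrow> (nat \<Rightarrow> 'k) \<Rightarrow> 'k::comm_semiring_1" where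
  "mono_eval m x = (\<Prod>i\<in>Poly_Mapping.keys m. x i ^ Poly_Mapping.lookup m i)"

definition mpoly_eval :: "'k mpoly \<Rightarrow> (nat \<Rightarrow> 'k) \<Rightarrow> 'k::comm_semiring_1" where
  "mpoly_eval p x = (\<Sum>m\<in>Poly_Mapping.keys p. Poly_Mapping.lookup p m * mono_eval m x)"

lemma mono_eval_superset:
  assumes "finite A" "Poly_Mapping.keys m \<subseteq> A"
  shows "mono_eval m x = (\<Prod>i\<in>A. x i ^ Poly_Mapping.lookup m i)"
  unfolding mono_eval_def
  by (rule prod.mono_neutral_left) (use assms in \<open>auto simp: in_keys_iff\<close>)

lemma mpoly_eval_superset:
  assumes "finite A" "Poly_Mapping.keys p \<subseteq> A"
  shows "mpoly_eval p x = (\<Sum>m\<in>A. Poly_Mapping.lookup p m * mono_eval m x)"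
  unfolding mpoly_eval_def
  by (rule sum.mono_neutral_left) (use assms in \<open>auto simp: in_keys_iff\<close>)

lemma mono_eval_add: "mono_eval (m + n) x = mono_eval m x * mono_eval n x"
proof -
  have fin: "finite (Poly_Mapping.keys m \<union> Poly_Mapping.keys n)" by simp
  show ?thesis
    unfolding mono_eval_superset[OF fin keys_add] mono_eval_superset[OF fin Un_upper1]
      mono_eval_superset[OF fin Un_upper2]
    by (simp add: lookup_add power_add prod.distrib)
qed

lemma mpoly_eval_zero [simp]: "mpoly_eval 0 x = 0"
  by (simp add: mpoly_eval_def)

lemma mpoly_eval_single [simp]: "mpoly_eval (Poly_Mapping.single m a) x = a * mono_eval m x"
  by (simp add: mpoly_eval_def)

lemma mpoly_eval_one [simp]: "mpoly_eval 1 x = 1"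
  by (simp add: mpoly_eval_def mono_eval_def)

lemma mpoly_eval_add: "mpoly_eval (p + q) x = mpoly_eval p x + mpoly_eval q x"
proof -
  have fin: "finite (Poly_Mapping.keys p \<union> Poly_Mapping.keys q)" by simp
  show ?thesis
    unfolding mpoly_eval_superset[OF fin keys_add] mpoly_eval_superset[OF fin Un_upper1]
      mpoly_eval_superset[OF fin Un_upper2]
    by (simp add: lookup_add distrib_right sum.distrib)
qed

lemma mpoly_induct [case_names zero add]:
  assumes "P 0"
    and "\<And>p m a. P p \<Longrightarrow> P (p + Poly_Mapping.single m a)"
  shows "P (p :: 'k::comm_semiring_1 mpoly)"
proof (induction p rule: update_induct)
  case const
  show ?case by (rule assms(1))
next
  case (update p m a)
  have "Poly_Mapping.update m a p = p + Poly_Mapping.single m a"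
    using update(1)
    by (intro poly_mapping_eqI)
       (auto simp: lookup_add lookup_update lookup_single when_def in_keys_iff)
  then show ?case using assms(2) update by simp
qed

lemma mpoly_eval_mult: "mpoly_eval (p * q) x = mpoly_eval p x * mpoly_eval q x"
proof (induction p rule: mpoly_induct)
  case zero
  show ?case by simp
next
  case (add p m a)
  have "mpoly_eval (Poly_Mapping.single m a * q) x = a * mono_eval m x * mpoly_eval q x"
  proof (induction q rule: mpoly_induct)
    case zero
    show ?case by simp
  next
    case (add q n b)
    then show ?case
      by (simp add: distrib_left mpoly_eval_add mult_single mono_eval_add algebra_simps)
  qed
  with add show ?case
    by (simp add: distrib_right mpoly_eval_add)
qed

lemma one_in_mpolys: "1 \<in> mpolys n"
  by (simp add: mpolys_def)

lemma mult_in_mpolys: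
  assumes "p \<in> mpolys n" "q \<in> mpolys n"
  shows "p * q \<in> mpolys n"
  unfolding mpolys_def
proof (intro CollectI ballI)
  fix m assume "m \<in> Poly_Mapping.keys (p * q)"
  then obtain a b where "m = a + b" "a \<in> Poly_Mapping.keys p" "b \<in> Poly_Mapping.keys q"
    using keys_mult[of p q] by blast
  then show "Poly_Mapping.keys m \<subseteq> {..<n}"
    using assms keys_add[of a b] unfolding mpolys_def by blast
qed

section \<open>Minimum cardinality\<close>

text \<open>Cardinals are well-order relations, to be compared with \<open>\<le>o\<close> and \<open>=o\<close>. By well-foundedness
  the choice below succeeds for every nonempty collection (lemma \<open>min_card_attained\<close>).\<close>

definition min_card :: "'b set set \<Rightarrow> 'b rel" where
  "min_card \<C> = |SOME C. C \<in> \<C> \<and> (\<forall>D\<in>\<C>. |C| \<le>o |D| )|"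

lemma min_card_attained:
  assumes "\<C> \<noteq> {}"
  shows "\<exists>C\<in>\<C>. min_card \<C> = |C| \<and> (\<forall>D\<in>\<C>. |C| \<le>o |D| )"
proof -
  have "\<exists>r\<in>card_of ` \<C>. \<forall>r'\<in>card_of ` \<C>. r \<le>o r'"
    by (rule exists_minim_Card_order) (use assms card_of_Card_order in auto)
  then have "\<exists>C. C \<in> \<C> \<and> (\<forall>D\<in>\<C>. |C| \<le>o |D| )"
    by auto
  from someI_ex[OF this] show ?thesis
    unfolding min_card_def by blast
qed

section \<open>Covering numbers\<close>

definition sigma_closed :: "'v topology \<Rightarrow> 'v set rel" where
  "sigma_closed T = min_card
     {\<C>. (\<forall>S\<in>\<C>. closedin T S \<and> S \<noteq> topspace T) \<and> \<Union>\<C> = topspace T}"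

definition sigma :: "('k::field \<Rightarrow> 'v::ab_group_add \<Rightarrow> 'v) \<Rightarrow> 'v set rel" where
  "sigma scale = min_card
     {\<C>. (\<forall>W\<in>\<C>. module.subspace scale W \<and> W \<noteq> UNIV) \<and> \<Union>\<C> = UNIV}"

section \<open>The induced Zariski topology\<close>

definition ordered_basis :: "('k::field \<Rightarrow> 'v::ab_group_add \<Rightarrow> 'v) \<Rightarrow> 'v list \<Rightarrow> bool" where
  "ordered_basis scale bs \<longleftrightarrow>
     distinct bs \<and> \<not> module.dependent scale (set bs) \<and> module.span scale (set bs) = UNIV"

text \<open>Only the values at \<open>i < length bs\<close> are meaningful; polynomials in \<open>mpolys (length bs)\<close> use no
  others.\<close>

definition coords :: "('k::field \<Rightarrow> 'v::ab_group_add \<Rightarrow> 'v) \<Rightarrow> 'v list \<Rightarrow> 'v \<Rightarrow> nat \<Rightarrow> 'k" where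
  "coords scale bs v i = module.representation scale (set bs) v (bs ! i)"

definition zariski_closed :: "('k::field \<Rightarrow> 'v::ab_group_add \<Rightarrow> 'v) \<Rightarrow> 'v list \<Rightarrow> 'v set \<Rightarrow> bool" where
  "zariski_closed scale bs S \<longleftrightarrow>
     (\<exists>F \<subseteq> mpolys (length bs). S = {v. \<forall>p\<in>F. mpoly_eval p (coords scale bs v) = 0})"

definition zariski_topology :: "('k::field \<Rightarrow> 'v::ab_group_add \<Rightarrow> 'v) \<Rightarrow> 'v list \<Rightarrow> 'v topology" where
  "zariski_topology scale bs = topology (\<lambda>U. zariski_closed scale bs (- U))"

lemma zariski_closed_Un:
  assumes "zariski_closed scale bs S" "zariski_closed scale bs T"
  shows "zariski_closed scale bs (S \<union> T)"
proof -
  obtain F where F: "F \<subseteq> mpolys (length bs)" "S = {v. \<forall>p\<in>F. mpoly_eval p (coords scale bs v) = 0}"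
    using assms(1) unfolding zariski_closed_def by blast
  obtain G where G: "G \<subseteq> mpolys (length bs)" "T = {v. \<forall>p\<in>G. mpoly_eval p (coords scale bs v) = 0}"
    using assms(2) unfolding zariski_closed_def by blast
  let ?H = "{p * q |p q. p \<in> F \<and> q \<in> G}"
  have "?H \<subseteq> mpolys (length bs)"
    using F(1) G(1) mult_in_mpolys by blast
  moreover have "S \<union> T = {v. \<forall>p\<in>?H. mpoly_eval p (coords scale bs v) = 0}"
  proof (intro set_eqI iffI)
    fix v assume "v \<in> S \<union> T"
    then show "v \<in> {v. \<forall>p\<in>?H. mpoly_eval p (coords scale bs v) = 0}"
      unfolding F(2) G(2) by (auto simp: mpoly_eval_mult)
  next
    fix v assume v: "v \<in> {v. \<forall>p\<in>?H. mpoly_eval p (coords scale bs v) = 0}"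
    show "v \<in> S \<union> T"
    proof (rule ccontr)
      assume "v \<notin> S \<union> T"
      then obtain p q where pq: "p \<in> F" "q \<in> G"
          "mpoly_eval p (coords scale bs v) \<noteq> 0" "mpoly_eval q (coords scale bs v) \<noteq> 0"
        unfolding F(2) G(2) by blast
      from v pq(1,2) have "mpoly_eval (p * q) (coords scale bs v) = 0" by blast
      with pq(3,4) show False by (simp add: mpoly_eval_mult)
    qed
  qed
  ultimately show ?thesis unfolding zariski_closed_def by blast
qed

lemma zariski_closed_Inter:
  assumes "\<And>S. S \<in> K \<Longrightarrow> zariski_closed scale bs S"
  shows "zariski_closed scale bs (\<Inter>K)"
proof -
  have "\<forall>S\<in>K. \<exists>F. F \<subseteq> mpolys (length bs) \<and>
      (\<forall>v. v \<in> S \<longleftrightarrow> (\<forall>p\<in>F. mpoly_eval p (coords scale bs v) = 0))"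
    using assms unfolding zariski_closed_def by blast
  from bchoice[OF this] obtain F where F: "\<forall>S\<in>K. F S \<subseteq> mpolys (length bs) \<and>
      (\<forall>v. v \<in> S \<longleftrightarrow> (\<forall>p\<in>F S. mpoly_eval p (coords scale bs v) = 0))" ..
  have "\<Inter>K = {v. \<forall>p\<in>\<Union>(F ` K). mpoly_eval p (coords scale bs v) = 0}"
    using F by auto
  moreover have "\<Union>(F ` K) \<subseteq> mpolys (length bs)" using F by blast
  ultimately show ?thesis unfolding zariski_closed_def by blast
qed

lemma zariski_closed_empty: "zariski_closed scale bs {}"
  unfolding zariski_closed_def by (rule exI[of _ "{1}"]) (simp add: one_in_mpolys)

lemma openin_zariski: "openin (zariski_topology scale bs) U \<longleftrightarrow> zariski_closed scale bs (- U)"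
proof -
  have "zariski_closed scale bs (- (\<Union>K))" if "\<forall>U\<in>K. zariski_closed scale bs (- U)" for K
    using zariski_closed_Inter[of "uminus ` K" scale bs] that by (auto simp: uminus_Sup)
  then have "istopology (\<lambda>U. zariski_closed scale bs (- U))"
    unfolding istopology_def by (simp add: zariski_closed_Un)
  then show ?thesis unfolding zariski_topology_def by (simp add: topology_inverse')
qed

lemma topspace_zariski [simp]: "topspace (zariski_topology scale bs) = UNIV"
  using openin_subset[of "zariski_topology scale bs" UNIV]
  by (auto simp: openin_zariski zariski_closed_empty)

lemma closedin_zariski: "closedin (zariski_topology scale bs) S \<longleftrightarrow> zariski_closed scale bs S"
  by (simp add: closedin_def openin_zariski Compl_eq_Diff_UNIV[symmetric])

lemma (in finite_dimensional_vector_space) ordered_basis_exists: "\<exists>bs. ordered_basis scale bs"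
  using finite_distinct_list[OF finite_Basis] independent_Basis span_Basis
  unfolding ordered_basis_def by metis

end

theory Submission
  imports Defs "HOL-Computational_Algebra.Polynomial"
begin

text \<open>
  Proper subspaces and proper Zariski closed sets share one property: a line that is not contained
  in such a set meets it in only finitely many points. For closed sets this holds because a
  polynomial restricted to a line is a univariate polynomial, which has finitely many roots unless
  it vanishes identically. Call a set with this property line-thin.

  Fewer than \<open>|K|\<close> proper line-thin sets cannot cover \<open>V\<close> (lemma \<open>line_thin_cover_card\<close>). Start with
  a point outside each of the sets, possibly a different point for each, and make the points agree
  in one basis direction after another. In each direction only finitely many scalars are bad for any
  one set, so fewer than \<open>|K|\<close> scalars are bad altogether, and some scalar is good for all sets at
  once. After the last direction all the points coincide, and the common point is not covered.

  Conversely, the hyperplanes containing a fixed subspace of codimension 2, a pencil indexed by the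
  projective line over \<open>K\<close>, cover \<open>V\<close>; they are both subspaces and Zariski closed. As \<open>K\<close> is
  infinite, \<open>|K| + 1 = |K|\<close>, so both covering numbers equal this cardinal.
\<close>

section \<open>Cardinals\<close>

lemma min_card_eqI:
  assumes "\<And>D. D \<in> \<C> \<Longrightarrow> r \<le>o |D|" and "D \<in> \<C>" and "|D| \<le>o r"
  shows "min_card \<C> =o r"
proof -
  obtain C where C: "C \<in> \<C>" "min_card \<C> = |C|" "\<forall>D\<in>\<C>. |C| \<le>o |D|"
    using min_card_attained[of \<C>] assms(2) by blast
  have "|C| \<le>o r"
    using C(3) assms(2,3) ordLeq_transitive by blast
  with C(1,2) assms(1) show ?thesis
    by (simp add: ordIso_iff_ordLeq)
qed

lemma finite_ordLeq_infinite:
  assumes "finite A" "infinite B"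
  shows "|A| \<le>o |B|"
  using finite_ordLess_infinite[OF card_of_Well_order card_of_Well_order, of A B] assms
  by (simp add: Field_card_of ordLess_imp_ordLeq)

text \<open>For finite \<open>C\<close> the union is finite; for infinite \<open>C\<close> it has at most \<open>|C|\<close> elements.\<close>

lemma UN_finite_neq_UNIV:
  assumes "infinite (UNIV :: 'k set)" and "|C| <o |UNIV :: 'k set|"
    and fin: "\<And>S. S \<in> C \<Longrightarrow> finite (A S)"
  shows "(\<Union>S\<in>C. A S) \<noteq> (UNIV :: 'k set)"
proof (cases "finite C")
  case True
  then have "finite (\<Union>S\<in>C. A S)" using fin by blast
  with assms(1) show ?thesis by metis
next
  case False
  have "|A S| \<le>o |C|" if "S \<in> C" for S
    by (rule finite_ordLeq_infinite[OF fin[OF that] False])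
  then have "|\<Union>S\<in>C. A S| \<le>o |C|"
    by (intro card_of_UNION_ordLeq_infinite[OF False]) (auto simp: card_of_mono1)
  with assms(2) show ?thesis
    using not_ordLess_ordLeq by metis
qed

section \<open>Line-thin sets\<close>

text \<open>The witness substitutes the affine function \<open>x i + t * u i\<close> of \<open>t\<close> for the \<open>i\<close>-th variable.\<close>

lemma mpoly_eval_on_line:
  "\<exists>q. \<forall>t. poly q t = mpoly_eval p (\<lambda>i. x i + t * u i)"
  by (rule exI[of _ "\<Sum>m\<in>Poly_Mapping.keys p. smult (Poly_Mapping.lookup p m)
        (\<Prod>i\<in>Poly_Mapping.keys m. [:x i, u i:] ^ Poly_Mapping.lookup m i)"])
     (simp add: mpoly_eval_def mono_eval_def poly_sum poly_prod)

locale vector_space_with_ordered_basis = vector_space scale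
  for scale :: "'a::field \<Rightarrow> 'b::ab_group_add \<Rightarrow> 'b" (infixr "*s" 75) +
  fixes bs :: "'b list"
  assumes basis: "ordered_basis scale bs"
begin

definition line_thin :: "'b set \<Rightarrow> bool" where
  "line_thin S \<longleftrightarrow> (\<forall>v u. v \<notin> S \<longrightarrow> finite {t. v + t *s u \<in> S})"

text \<open>Two different points of \<open>W\<close> on a line put the whole line into \<open>W\<close>, so a line through a point
  outside \<open>W\<close> meets \<open>W\<close> at most once.\<close>

lemma subspace_line_thin:
  assumes "subspace W"
  shows "line_thin W"
  unfolding line_thin_def
proof (intro allI impI)
  fix v u assume v: "v \<notin> W"
  have "s = t" if st: "v + s *s u \<in> W" "v + t *s u \<in> W" for s t
  proof (rule ccontr)
    assume "s \<noteq> t"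
    have "(s - t) *s u \<in> W"
      using subspace_diff[OF assms st] by (simp add: scale_left_diff_distrib)
    then have "inverse (s - t) *s ((s - t) *s u) \<in> W"
      by (rule subspace_scale[OF assms])
    with \<open>s \<noteq> t\<close> have "u \<in> W" by simp
    then have "v + s *s u - s *s u \<in> W"
      by (intro subspace_diff[OF assms] subspace_scale[OF assms] st)
    with v show False by simp
  qed
  then have "{t. v + t *s u \<in> W} \<subseteq> {s}" if "v + s *s u \<in> W" for s
    using that by auto
  then show "finite {t. v + t *s u \<in> W}"
    by (metis (mono_tags, lifting) empty_Collect_eq finite.emptyI finite.insertI finite_subset)
qed

lemma coords_line:
  shows "coords scale bs (v + t *s u) = (\<lambda>i. coords scale bs v i + t * coords scale bs u i)"
  using basis unfolding ordered_basis_def coords_def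
  by (simp add: fun_eq_iff representation_add representation_scale)

lemma coords_basis:
  assumes "i < length bs" "j < length bs"
  shows "coords scale bs (bs ! j) i = (if i = j then 1 else 0)"
  using basis assms unfolding ordered_basis_def coords_def
  by (simp add: representation_basis nth_eq_iff_index_eq)

lemma length_ordered_basis:
  shows "length bs = dim UNIV"
  using basis dim_eq_card[of "set bs" UNIV] unfolding ordered_basis_def
  by (simp add: distinct_card span_UNIV)

lemma zariski_closed_line_thin:
  assumes "zariski_closed scale bs S"
  shows "line_thin S"
  unfolding line_thin_def
proof (intro allI impI)
  fix v u assume "v \<notin> S"
  obtain F where S: "S = {v. \<forall>p\<in>F. mpoly_eval p (coords scale bs v) = 0}"
    using assms unfolding zariski_closed_def by blast
  with \<open>v \<notin> S\<close> obtain p where p: "p \<in> F" "mpoly_eval p (coords scale bs v) \<noteq> 0"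
    by blast
  obtain q where q: "poly q t = mpoly_eval p (coords scale bs (v + t *s u))" for t
    unfolding coords_line using mpoly_eval_on_line by blast
  have "q \<noteq> 0"
    using q[of 0] p(2) by auto
  then have "finite {t. poly q t = 0}"
    by (rule poly_roots_finite)
  moreover have "{t. v + t *s u \<in> S} \<subseteq> {t. poly q t = 0}"
    using p(1) S q by auto
  ultimately show "finite {t. v + t *s u \<in> S}"
    by (rule finite_subset[rotated])
qed

section \<open>Lower bound for covers by line-thin sets\<close>

text \<open>The witnesses \<open>w + r\<close> of the hypothesis may differ from set to set; each step of the induction
  replaces their components along one element of \<open>B\<close> by a common value, which is absorbed
  into \<open>w\<close>.\<close>

lemma common_point_avoiding_line_thin_sets:
  assumes K: "infinite (UNIV :: 'a set)" and C: "|C| <o |UNIV :: 'a set|"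
    and thin: "\<And>S. S \<in> C \<Longrightarrow> line_thin S"
    and "finite B" and "\<And>S. S \<in> C \<Longrightarrow> \<exists>r\<in>span B. w + r \<notin> S"
  shows "\<exists>x. \<forall>S\<in>C. x \<notin> S"
  using assms(4,5)
proof (induction B arbitrary: w rule: finite_induct)
  case empty
  then have "\<forall>S\<in>C. w \<notin> S" by auto
  then show ?case by blast
next
  case (insert b B)
  have "\<exists>r\<in>span B. \<exists>s. w + r + s *s b \<notin> S" if "S \<in> C" for S
  proof -
    obtain r where r: "r \<in> span (insert b B)" "w + r \<notin> S"
      using insert.prems \<open>S \<in> C\<close> by blast
    obtain s where "r - s *s b \<in> span B"
      using r(1) by (auto simp: span_insert)
    moreover have "w + (r - s *s b) + s *s b \<notin> S"
      using r(2) by simp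
    ultimately show ?thesis by blast
  qed
  then obtain r s where r: "S \<in> C \<Longrightarrow> r S \<in> span B"
      and rs: "S \<in> C \<Longrightarrow> w + r S + s S *s b \<notin> S" for S
    by metis
  have "finite {t. w + r S + t *s b \<in> S}" if "S \<in> C" for S
  proof -
    \<comment> \<open>Thinness counts parameters from a point outside \<open>S\<close>; shifting them by \<open>s S\<close> counts them
      from \<open>w + r S\<close>, which may lie in \<open>S\<close>.\<close>
    have "finite {t. (w + r S + s S *s b) + t *s b \<in> S}"
      using thin[OF that] rs[OF that] unfolding line_thin_def by blast
    then have "finite ((\<lambda>t. s S + t) ` {t. (w + r S + s S *s b) + t *s b \<in> S})"
      by (rule finite_imageI)
    moreover have "{t. w + r S + t *s b \<in> S}
        \<subseteq> (\<lambda>t. s S + t) ` {t. (w + r S + s S *s b) + t *s b \<in> S}"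
    proof
      fix t assume "t \<in> {t. w + r S + t *s b \<in> S}"
      then have "t - s S \<in> {t. (w + r S + s S *s b) + t *s b \<in> S}"
        by (simp add: scale_left_diff_distrib)
      then show "t \<in> (\<lambda>t. s S + t) ` {t. (w + r S + s S *s b) + t *s b \<in> S}"
        by (rule rev_image_eqI) simp
    qed
    ultimately show ?thesis
      by (rule finite_subset[rotated])
  qed
  then have "(\<Union>S\<in>C. {t. w + r S + t *s b \<in> S}) \<noteq> UNIV"
    by (rule UN_finite_neq_UNIV[OF K C])
  then obtain t where t: "\<And>S. S \<in> C \<Longrightarrow> w + r S + t *s b \<notin> S"
    by blast
  have "\<exists>r\<in>span B. (w + t *s b) + r \<notin> S" if "S \<in> C" for S
    using r[OF that] t[OF that] by (intro bexI[of _ "r S"]) (simp_all add: add_ac)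
  then show ?case
    by (rule insert.IH)
qed

text \<open>Taking \<open>w = 0\<close> above, properness of the sets provides the witnesses.\<close>

lemma line_thin_cover_card:
  assumes "infinite (UNIV :: 'a set)" and "finite B" and "span B = UNIV"
    and thin: "\<And>S. S \<in> C \<Longrightarrow> line_thin S \<and> S \<noteq> UNIV" and cover: "\<Union>C = UNIV"
  shows "|UNIV :: 'a set| \<le>o |C|"
proof (rule ccontr)
  assume "\<not> |UNIV :: 'a set| \<le>o |C|"
  then have "|C| <o |UNIV :: 'a set|"
    using ordLess_or_ordLeq[OF card_of_Well_order card_of_Well_order] by blast
  moreover have "\<exists>r\<in>span B. 0 + r \<notin> S" if "S \<in> C" for S
    using thin[OF that] assms(3) by auto
  ultimately have "\<exists>x. \<forall>S\<in>C. x \<notin> S"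
    using common_point_avoiding_line_thin_sets[of C B 0] assms(1,2) thin by blast
  with cover show False by blast
qed

section \<open>A pencil of hyperplanes\<close>

definition pencil_member :: "'a \<Rightarrow> 'a \<Rightarrow> 'b set" where
  "pencil_member a b = {v. a * coords scale bs v 0 + b * coords scale bs v 1 = 0}"

text \<open>One member for each point of the projective line over the field.\<close>

definition pencil :: "'b set set" where
  "pencil = insert (pencil_member 0 1) (range (\<lambda>c. pencil_member 1 (- c)))"

lemma subspace_pencil_member:
  shows "subspace (pencil_member a b)"
proof (rule subspaceI)
  show "0 \<in> pencil_member a b"
    by (simp add: pencil_member_def coords_def representation_zero)
next
  fix v u assume "v \<in> pencil_member a b" "u \<in> pencil_member a b"
  moreover have "a * (x + y) + b * (z + w) = (a * x + b * z) + (a * y + b * w)" for x y z w :: 'a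
    by (simp add: algebra_simps)
  ultimately show "v + u \<in> pencil_member a b"
    using coords_line[of v 1 u] by (simp add: pencil_member_def)
next
  fix c v assume "v \<in> pencil_member a b"
  moreover have "a * (c * x) + b * (c * y) = c * (a * x + b * y)" for x y :: 'a
    by (simp add: algebra_simps)
  moreover have "coords scale bs 0 = (\<lambda>i. 0)"
    by (simp add: coords_def representation_zero fun_eq_iff)
  ultimately show "c *s v \<in> pencil_member a b"
    using coords_line[of 0 c v] by (simp add: pencil_member_def)
qed

lemma zariski_closed_pencil_member:
  assumes "length bs \<ge> 2"
  shows "zariski_closed scale bs (pencil_member a b)"
proof -
  let ?X = "\<lambda>i. Poly_Mapping.single i (1::nat)"
  let ?p = "Poly_Mapping.single (?X (0::nat)) a + Poly_Mapping.single (?X 1) b"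
  have "?p \<in> mpolys (length bs)"
    unfolding mpolys_def using keys_add[of "Poly_Mapping.single (?X 0) a" "Poly_Mapping.single (?X 1) b"] assms
    by (fastforce split: if_splits)
  moreover have "mpoly_eval ?p x = a * x 0 + b * x 1" for x
    by (simp add: mpoly_eval_add mono_eval_def)
  ultimately show ?thesis
    unfolding zariski_closed_def pencil_member_def by (intro exI[of _ "{?p}"]) simp
qed

lemma pencil_member_proper:
  assumes len2: "length bs \<ge> 2" and "a \<noteq> 0 \<or> b \<noteq> 0"
  shows "pencil_member a b \<noteq> UNIV"
proof -
  have len: "0 < length bs" "1 < length bs" using len2 by auto
  have "a = 0" if "bs ! 0 \<in> pencil_member a b"
    using that coords_basis[OF len(1) len(1)] coords_basis[OF len(2) len(1)]
    by (simp add: pencil_member_def)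
  moreover have "b = 0" if "bs ! 1 \<in> pencil_member a b"
    using that coords_basis[OF len(1) len(2)] coords_basis[OF len(2) len(2)]
    by (simp add: pencil_member_def)
  ultimately show ?thesis
    using assms(2) by blast
qed

lemma Union_pencil: "\<Union>(pencil) = UNIV"
proof -
  have "v \<in> \<Union>(pencil)" for v
  proof (cases "coords scale bs v 1 = 0")
    case True
    then have "v \<in> pencil_member 0 1" by (simp add: pencil_member_def)
    then show ?thesis by (simp add: pencil_def)
  next
    case False
    then have "v \<in> pencil_member 1 (- (coords scale bs v 0 / coords scale bs v 1))"
      by (simp add: pencil_member_def)
    then show ?thesis unfolding pencil_def by blast
  qed
  then show ?thesis by blast
qed

lemma card_of_pencil:
  assumes "infinite (UNIV :: 'a set)"
  shows "|pencil| \<le>o |UNIV :: 'a set|"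
proof -
  have "|{pencil_member 0 1} \<union> range (\<lambda>c. pencil_member 1 (- c))| \<le>o |UNIV :: 'a set|"
    using assms
    by (intro Un_Cinfinite_bound conjI finite_ordLeq_infinite card_of_image card_of_Card_order)
       (simp_all add: cinfinite_def Field_card_of)
  then show ?thesis
    by (simp add: pencil_def)
qed

lemma pencil_members:
  assumes "length bs \<ge> 2" "S \<in> pencil"
  shows "subspace S" "zariski_closed scale bs S" "S \<noteq> UNIV"
proof -
  obtain a b where S: "S = pencil_member a b" "a \<noteq> 0 \<or> b \<noteq> 0"
    using assms(2) unfolding pencil_def by auto
  then show "subspace S" "zariski_closed scale bs S" "S \<noteq> UNIV"
    using assms subspace_pencil_member zariski_closed_pencil_member pencil_member_proper by simp_all
qed

section \<open>The covering numbers\<close>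

lemma sigma_eq:
  assumes "infinite (UNIV :: 'a set)" "length bs \<ge> 2"
  shows "sigma scale =o |UNIV :: 'a set|"
  unfolding sigma_def
proof (rule min_card_eqI[OF _ _ card_of_pencil[OF assms(1)]])
  fix C assume "C \<in> {\<C>. (\<forall>W\<in>\<C>. subspace W \<and> W \<noteq> UNIV) \<and> \<Union>\<C> = UNIV}"
  then show "|UNIV :: 'a set| \<le>o |C|"
    using basis unfolding ordered_basis_def
    by (intro line_thin_cover_card[OF assms(1), of "set bs"]) (auto intro: subspace_line_thin)
next
  show "pencil \<in> {\<C>. (\<forall>W\<in>\<C>. subspace W \<and> W \<noteq> UNIV) \<and> \<Union>\<C> = UNIV}"
    using pencil_members[OF assms(2)] Union_pencil by blast
qed

lemma sigma_closed_eq: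
  assumes "infinite (UNIV :: 'a set)" "length bs \<ge> 2"
  shows "sigma_closed (zariski_topology scale bs) =o |UNIV :: 'a set|"
  unfolding sigma_closed_def closedin_zariski topspace_zariski
proof (rule min_card_eqI[OF _ _ card_of_pencil[OF assms(1)]])
  fix C assume "C \<in> {\<C>. (\<forall>S\<in>\<C>. zariski_closed scale bs S \<and> S \<noteq> UNIV) \<and> \<Union>\<C> = UNIV}"
  then show "|UNIV :: 'a set| \<le>o |C|"
    using basis zariski_closed_line_thin unfolding ordered_basis_def
    by (intro line_thin_cover_card[OF assms(1), of "set bs"]) auto
next
  show "pencil \<in> {\<C>. (\<forall>S\<in>\<C>. zariski_closed scale bs S \<and> S \<noteq> UNIV) \<and> \<Union>\<C> = UNIV}"
    using pencil_members[OF assms(2)] Union_pencil by blast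
qed

end

theorem theorem3p1:
  fixes scale :: "'k::field \<Rightarrow> 'v::ab_group_add \<Rightarrow> 'v"
    and Basis :: "'v set"
    and bs :: "'v list"
  assumes "infinite (UNIV :: 'k set)"
    and "finite_dimensional_vector_space scale Basis"
    and "vector_space.dim scale (UNIV :: 'v set) \<ge> 2"
    and "ordered_basis scale bs"
  shows "sigma_closed (zariski_topology scale bs) =o sigma scale
       \<and> sigma scale =o |UNIV :: 'k set| +c cone"
proof -
  interpret finite_dimensional_vector_space scale Basis
    by (rule assms(2))
  interpret vector_space_with_ordered_basis scale bs
    by unfold_locales (rule assms(4))
  have len: "length bs \<ge> 2"
    using assms(3) length_ordered_basis by simp
  have K: "|UNIV :: 'k set| =o |UNIV :: 'k set| +c cone"
    unfolding cone_def
    using assms(1)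
    by (intro ordIso_symmetric[OF csum_absorb1] conjI finite_ordLeq_infinite card_of_Card_order)
       (simp_all add: cinfinite_def Field_card_of)
  show ?thesis
    using sigma_eq[OF assms(1) len] sigma_closed_eq[OF assms(1) len] K
    by (meson ordIso_symmetric ordIso_transitive)
qed

end
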